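(* Let $f:\mathbb{R}^n\to\mathbb{R}\cup\{+\infty\}$ be a proper function and let $e$ be an error bifunction with $\operatorname{dom} f\times\operatorname{dom} f\subseteq\operatorname{dom} e$. Then $f$ is $e$-convex if and only if for every $x^{\ast}\in\mathbb{R}^n$ the function $f+x^{\ast}:\ x\mapsto f(x)+\langle x^{\ast},x\rangle$ is $e$-quasiconvex.
   Context: For $f:\mathbb{R}^n\to\mathbb{R}\cup\{+\infty\}$, $\operatorname{dom} f=\{x: f(x)<+\infty\}$; $f$ is proper if it never takes the value $-\infty$ and $\operatorname{dom} f\neq\emptyset$. An error bifunction is a map $e:\mathbb{R}^n\times\mathbb{R}^n\to\mathbb{R}\cup\{+\infty\}$ such that $\operatorname{dom} e:=\{(x,y): e(x,y)<+\infty\}\neq\emptyset$, $e\ge 0$, and $e(x,y)=e(y,x)$ for all $(x,y)\in\operatorname{dom} e$. Let $e$ be an error bifunction with $\operatorname{dom} f\times\operatorname{dom} f\subseteq\operatorname{dom} e$. The function $f$ is $e$-convex if for all $x,y\in\mathbb{R}^n$ and all $t\in\,]0,1[$, $$f(tx+(1-t)y)\le t f(x)+(1-t)f(y)+t(1-t)e(x,y).$$ The function $f$ is $e$-quasiconvex if for all $x,y\in\mathbb{R}^n$ and all $t\in\,]0,1[$, $$f(tx+(1-t)y)\le \max\{f(x),f(y)\}+t(1-t)e(x,y).$$ *)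

theory Defs
  imports "HOL-Analysis.Analysis"
begin

definition eff_dom :: "('a \<Rightarrow> ereal) \<Rightarrow> 'a set" where
  "eff_dom f = {x. f x < \<infinity>}"

definition proper_fun :: "('a \<Rightarrow> ereal) \<Rightarrow> bool" where
  "proper_fun f \<longleftrightarrow> (\<forall>x. f x \<noteq> -\<infinity>) \<and> eff_dom f \<noteq> {}"

(* Symmetry is required only on the domain of e. Nonnegativity excludes the value -\<infinity>. *)
definition error_bifunction :: "('a \<times> 'a \<Rightarrow> ereal) \<Rightarrow> bool" where
  "error_bifunction e \<longleftrightarrow>
     eff_dom e \<noteq> {} \<and>
     (\<forall>x y. 0 \<le> e (x, y)) \<and>
     (\<forall>x y. (x, y) \<in> eff_dom e \<longrightarrow> e (x, y) = e (y, x))"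

(* The next two predicates are meant for f without the value -\<infinity> and for an error bifunction e
   with eff_dom f \<times> eff_dom f \<subseteq> eff_dom e; then no sum below has the form \<infinity> + (-\<infinity>). *)
definition e_convex :: "('a \<times> 'a \<Rightarrow> ereal) \<Rightarrow> ('a::real_vector \<Rightarrow> ereal) \<Rightarrow> bool" where
  "e_convex e f \<longleftrightarrow>
     (\<forall>x y. \<forall>t::real. 0 < t \<and> t < 1 \<longrightarrow>
        f (t *\<^sub>R x + (1 - t) *\<^sub>R y)
          \<le> ereal t * f x + ereal (1 - t) * f y + ereal (t * (1 - t)) * e (x, y))"

definition e_quasiconvex :: "('a \<times> 'a \<Rightarrow> ereal) \<Rightarrow> ('a::real_vector \<Rightarrow> ereal) \<Rightarrow> bool" where
  "e_quasiconvex e f \<longleftrightarrow>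
     (\<forall>x y. \<forall>t::real. 0 < t \<and> t < 1 \<longrightarrow>
        f (t *\<^sub>R x + (1 - t) *\<^sub>R y)
          \<le> max (f x) (f y) + ereal (t * (1 - t)) * e (x, y))"

end

theory Submission
  imports Defs
begin

text \<open>
  Adding a linear function preserves e-convexity, and e-convexity implies e-quasiconvexity.
  Conversely, for distinct \<open>x\<close> and \<open>y\<close> in the domain of \<open>f\<close> there is a linear function
  for which \<open>f + x\<^sup>*\<close> takes the same value at \<open>x\<close> and at \<open>y\<close>. The maximum of these
  two values is then also their convex combination, and subtracting the linear function from the
  e-quasiconvexity inequality gives the e-convexity inequality.
\<close>

text \<open>A linear function satisfies the convexity inequality with equality, so both sides gain
  the same real number \<open>u \<bullet> ?z\<close>. Excluding -\<infinity> for \<open>f\<close>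
  and \<open>e\<close> keeps the extended sums well behaved.\<close>

lemma e_convex_add_inner:
  fixes f :: "'a::real_inner \<Rightarrow> ereal"
  assumes f: "\<And>x. f x \<noteq> -\<infinity>" and e: "\<And>x y. 0 \<le> e (x, y)" and conv: "e_convex e f"
  shows "e_convex e (\<lambda>x. f x + ereal (u \<bullet> x))"
  unfolding e_convex_def
proof (intro allI impI)
  fix x y :: 'a and t :: real
  assume t: "0 < t \<and> t < 1"
  let ?z = "t *\<^sub>R x + (1 - t) *\<^sub>R y"
  have "f ?z \<le> ereal t * f x + ereal (1 - t) * f y + ereal (t * (1 - t)) * e (x, y)"
    using conv t unfolding e_convex_def by blast
  moreover have "u \<bullet> ?z = t * (u \<bullet> x) + (1 - t) * (u \<bullet> y)"
    by (simp add: inner_add_right)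
  ultimately show "f ?z + ereal (u \<bullet> ?z) \<le> ereal t * (f x + ereal (u \<bullet> x))
      + ereal (1 - t) * (f y + ereal (u \<bullet> y)) + ereal (t * (1 - t)) * e (x, y)"
    using f[of x] f[of y] f[of ?z] e[of x y] t
    by (cases "f x"; cases "f y"; cases "e (x, y)"; cases "f ?z") (auto simp: algebra_simps)
qed

lemma e_convex_imp_e_quasiconvex:
  fixes f :: "'a::real_vector \<Rightarrow> ereal"
  assumes f: "\<And>x. f x \<noteq> -\<infinity>" and conv: "e_convex e f"
  shows "e_quasiconvex e f"
  unfolding e_quasiconvex_def
proof (intro allI impI)
  fix x y :: 'a and t :: real
  assume t: "0 < t \<and> t < 1"
  let ?m = "max (f x) (f y)"
  have "f (t *\<^sub>R x + (1 - t) *\<^sub>R y)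
      \<le> ereal t * f x + ereal (1 - t) * f y + ereal (t * (1 - t)) * e (x, y)"
    using conv t unfolding e_convex_def by blast
  also have "ereal t * f x + ereal (1 - t) * f y \<le> ereal t * ?m + ereal (1 - t) * ?m"
    using t by (intro add_mono ereal_mult_left_mono) auto
  also have "\<dots> = ?m"
    using t f[of x] f[of y] by (cases ?m) (auto simp: algebra_simps max_def split: if_splits)
  finally show "f (t *\<^sub>R x + (1 - t) *\<^sub>R y) \<le> ?m + ereal (t * (1 - t)) * e (x, y)"
    by (simp add: add_right_mono)
qed

lemma e_convex_of_tilts:
  fixes f :: "'a::real_inner \<Rightarrow> ereal"
  assumes f: "\<And>x. f x \<noteq> -\<infinity>" and e: "\<And>x y. 0 \<le> e (x, y)"
    and quasi: "\<And>u. e_quasiconvex e (\<lambda>x. f x + ereal (u \<bullet> x))"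
  shows "e_convex e f"
  unfolding e_convex_def
proof (intro allI impI)
  fix x y :: 'a and t :: real
  assume t: "0 < t \<and> t < 1"
  let ?z = "t *\<^sub>R x + (1 - t) *\<^sub>R y"
  have te: "0 \<le> ereal (t * (1 - t)) * e (x, y)"
    using t e by simp
  show "f ?z \<le> ereal t * f x + ereal (1 - t) * f y + ereal (t * (1 - t)) * e (x, y)"
  proof (cases "f x = \<infinity> \<or> f y = \<infinity> \<or> e (x, y) = \<infinity>")
    \<comment> \<open>All three coefficients are positive and no summand is -\<infinity>, so the
      right-hand side is \<infinity>.\<close>
    case True
    then show ?thesis
      using t f[of x] f[of y] e[of x y]
      by (cases "f x"; cases "f y"; cases "e (x, y)") auto
  next
    case False
    then obtain a b c where abc: "f x = ereal a" "f y = ereal b" "e (x, y) = ereal c"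
      using f[of x] f[of y] e[of x y] by (cases "f x"; cases "f y"; cases "e (x, y)") auto
    show ?thesis
    proof (cases "x = y")
      case True
      \<comment> \<open>The inequality reduces to nonnegativity of the error term.\<close>
      then have "?z = x" "a = b"
        using abc by (auto simp: algebra_simps)
      then show ?thesis
        using True abc te by (simp add: algebra_simps)
    next
      case False
      \<comment> \<open>The multiple of \<open>y - x\<close> is scaled so that the change of the
        linear part from \<open>x\<close> to \<open>y\<close> cancels the change
        \<open>b - a\<close> of \<open>f\<close>. It depends on the pair but not on
        \<open>t\<close>.\<close>
      define u where "u = ((a - b) / ((y - x) \<bullet> (y - x))) *\<^sub>R (y - x)"
      have "u \<bullet> (y - x) = a - b"
        using False by (simp add: u_def)
      then have tilt: "a + u \<bullet> x = b + u \<bullet> y"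
        by (simp add: inner_diff_right)
      have "f ?z + ereal (u \<bullet> ?z)
          \<le> max (f x + ereal (u \<bullet> x)) (f y + ereal (u \<bullet> y)) + ereal (t * (1 - t)) * e (x, y)"
        using quasi[of u] t unfolding e_quasiconvex_def by blast
      also have "\<dots> = ereal (b + u \<bullet> y + t * (1 - t) * c)"
        by (simp add: abc tilt)
      \<comment> \<open>Splitting the common value with weights \<open>t\<close> and
        \<open>1 - t\<close> makes the linear parts add up to \<open>u \<bullet> ?z\<close>, which
        is finite and cancels from both sides.\<close>
      also have "b + u \<bullet> y = t * (a + u \<bullet> x) + (1 - t) * (b + u \<bullet> y)"
        by (simp add: tilt algebra_simps)
      also have "\<dots> = t * a + (1 - t) * b + u \<bullet> ?z"
        by (simp add: inner_add_right algebra_simps)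
      finally show ?thesis
        using abc by (cases "f ?z") auto
    qed
  qed
qed

theorem proposition10:
  fixes f :: "real ^ 'n \<Rightarrow> ereal"
    and e :: "(real ^ 'n) \<times> (real ^ 'n) \<Rightarrow> ereal"
  assumes "proper_fun f"
    and "error_bifunction e"
    and "eff_dom f \<times> eff_dom f \<subseteq> eff_dom e"
  shows "e_convex e f \<longleftrightarrow>
    (\<forall>xs :: real ^ 'n. e_quasiconvex e (\<lambda>x. f x + ereal (xs \<bullet> x)))"
proof -
  have f: "f x \<noteq> -\<infinity>" for x
    using assms(1) by (simp add: proper_fun_def)
  have e: "0 \<le> e (x, y)" for x y
    using assms(2) by (simp add: error_bifunction_def)
  have "e_quasiconvex e (\<lambda>x. f x + ereal (xs \<bullet> x))" if "e_convex e f" for xs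
    using f by (intro e_convex_imp_e_quasiconvex e_convex_add_inner e that) auto
  then show ?thesis
    using e_convex_of_tilts[of f e] f e by blast
qed

end
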